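(* Let $a<b$ be real numbers, let $r,s$ be positive continuous functions on $(a,b)$ and let $p$ be a positive integer. Then for all measurable functions $f\ge 0$ on $(a,b)$ such that all integrals below exist and are finite, $$\int_a^b r(x)\left(\int_x^b f(t)\,dt\right)^{p+1}dx\le C\int_a^b s(x)\,(f(x))^{p+1}\,dx,$$ where $$C=\sup_{a<x<b}\left(\int_a^x r(t)\,dt\right)\left(\int_a^b s^{-\frac1p}(x)\,dx\right)^p.$$
   Context: Standing assumption: all functions are measurable and all the integrals appearing in the inequality and in $C$ (including $\int_a^x r$ and $\int_x^b f$ for $x\in(a,b)$) exist and are finite. In $C$ the supremum is of $\int_a^x r(t)\,dt$ (the other factor does not depend on $x$) and is taken in $[0,+\infty]$, with $0\cdot\infty=0$. *)

theory Defs
  imports "HOL-Analysis.Analysis"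
begin

text \<open>
  The constant \<open>C\<close>. It takes values in \<open>[0, \<infinity>]\<close>, because \<open>r\<close> need not be integrable up to \<open>b\<close>,
  in which case the supremum is \<open>\<infinity>\<close>; multiplication on \<^typ>\<open>ennreal\<close> satisfies \<open>0 * \<infinity> = 0\<close>.
  The definition is meaningful when \<open>r\<close> is nonnegative and integrable on each \<open>(a, x)\<close> with
  \<open>x < b\<close>, and \<open>s powr (- 1 / p)\<close> is integrable on \<open>(a, b)\<close>: Bochner integrals of non-integrable
  functions are \<open>0\<close>.
\<close>

definition hardy_const ::
    "real \<Rightarrow> real \<Rightarrow> (real \<Rightarrow> real) \<Rightarrow> (real \<Rightarrow> real) \<Rightarrow> nat \<Rightarrow> ennreal" where
  "hardy_const a b r s p =
     (SUP x\<in>{a<..<b}. ennreal (LINT t:{a<..<x}|lebesgue. r t)) *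
     ennreal ((LINT x:{a<..<b}|lebesgue. s x powr (- 1 / real p)) ^ p)"

end

theory Submission
  imports Defs
begin

text \<open>
  Put \<open>w = s powr (- 1 / p)\<close> and \<open>K = \<integral>\<^sub>a\<^sup>b w\<close>, so that
  \<open>s f\<^sup>p\<^sup>+\<^sup>1 = f\<^sup>p\<^sup>+\<^sup>1 / w\<^sup>p\<close>. Hoelder's inequality bounds \<open>(\<integral>\<^sub>x\<^sup>b f)\<^sup>p\<^sup>+\<^sup>1\<close> by \<open>K\<^sup>p \<integral>\<^sub>x\<^sup>b s f\<^sup>p\<^sup>+\<^sup>1\<close>; multiplying by \<open>r x\<close>, integrating over \<open>x\<close> and
  exchanging the order of integration leaves \<open>K\<^sup>p \<integral> s f\<^sup>p\<^sup>+\<^sup>1 (t) (\<integral>\<^sub>a\<^sup>t r) dt\<close>.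
\<close>

text \<open>The graph of the convex function \<open>y ^ (n + 1)\<close> lies above its tangent at
  \<open>m\<close>. After scaling by \<open>m ^ (n + 1)\<close> this is Bernoulli's inequality for
  \<open>y / m - 1 \<ge> -1\<close>.\<close>

lemma tangent_line_power:
  fixes y m :: real
  assumes "y \<ge> 0" "m \<ge> 0"
  shows "(real n + 1) * m ^ n * y \<le> y ^ (n + 1) + real n * m ^ (n + 1)"
proof (cases "m = 0")
  case True
  \<comment> \<open>The split on \<open>n\<close> is due to \<open>0 ^ 0 = 1\<close>: for
    \<open>n = 0\<close> the left side is \<open>y\<close>, otherwise it is
    \<open>0\<close>.\<close>
  then show ?thesis using assms by (cases n) auto
next
  case False
  with assms have m: "m > 0" by simp
  have "1 + real (n + 1) * (y / m - 1) \<le> (1 + (y / m - 1)) ^ (n + 1)"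
    by (rule Bernoulli_inequality) (use assms in simp)
  then have "(1 + real (n + 1) * (y / m - 1)) * m ^ (n + 1) \<le> (y / m) ^ (n + 1) * m ^ (n + 1)"
    using m by (intro mult_right_mono) auto
  also have "\<dots> = y ^ (n + 1)"
    using m by (simp add: power_divide del: power_Suc)
  also have "(1 + real (n + 1) * (y / m - 1)) * m ^ (n + 1)
      = (real n + 1) * m ^ n * y - real n * m ^ (n + 1)"
    using m by (simp add: field_simps)
  finally show ?thesis by simp
qed

text \<open>The proof applies the tangent line to the power function at \<open>\<integral>f / \<integral>w\<close> to the values \<open>f / w\<close>.\<close>

lemma Holder_power_weight:
  fixes f w :: "'a \<Rightarrow> real"
  assumes f: "set_integrable M A f" and w: "set_integrable M A w"
    and fw: "set_integrable M A (\<lambda>x. f x ^ (n + 1) / w x ^ n)"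
    and f_nonneg: "\<And>x. x \<in> A \<Longrightarrow> f x \<ge> 0" and w_pos: "\<And>x. x \<in> A \<Longrightarrow> w x > 0"
  shows "(LINT x:A|M. f x) ^ (n + 1)
    \<le> (LINT x:A|M. w x) ^ n * (LINT x:A|M. f x ^ (n + 1) / w x ^ n)"
proof -
  define F where "F = (LINT x:A|M. f x)"
  define K where "K = (LINT x:A|M. w x)"
  define H where "H = (LINT x:A|M. f x ^ (n + 1) / w x ^ n)"
  have F0: "F \<ge> 0"
    unfolding F_def set_lebesgue_integral_def
    by (rule integral_nonneg_AE) (auto simp: indicator_def f_nonneg)
  have K0: "K \<ge> 0"
    unfolding K_def set_lebesgue_integral_def
    by (rule integral_nonneg_AE) (auto simp: indicator_def less_imp_le[OF w_pos])
  \<comment> \<open>The tangent inequality at \<open>f x / w x\<close>, multiplied by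
    \<open>w x\<close>, has a left side linear in \<open>f x\<close>, so integration yields
    \<open>F\<close>, \<open>H\<close> and \<open>K\<close>. The slope parameter \<open>m\<close>
    stays free: it is taken to be \<open>F / K\<close> when \<open>K > 0\<close>, and
    \<open>0\<close> when \<open>K = 0\<close>.\<close>
  have tangent: "(real n + 1) * m ^ n * F \<le> H + real n * m ^ (n + 1) * K" if m: "m \<ge> 0" for m
  proof -
    have "(LINT x:A|M. (real n + 1) * m ^ n * f x)
        \<le> (LINT x:A|M. f x ^ (n + 1) / w x ^ n + real n * m ^ (n + 1) * w x)"
    proof (rule set_integral_mono)
      fix x assume x: "x \<in> A"
      have "((real n + 1) * m ^ n * (f x / w x)) * w x
          \<le> ((f x / w x) ^ (n + 1) + real n * m ^ (n + 1)) * w x"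
        using x m f_nonneg[OF x] w_pos[OF x]
        by (intro mult_right_mono tangent_line_power) auto
      then show "(real n + 1) * m ^ n * f x
          \<le> f x ^ (n + 1) / w x ^ n + real n * m ^ (n + 1) * w x"
        using w_pos[OF x] by (simp add: distrib_right power_divide add_divide_distrib)
    qed (intro set_integrable_mult_right set_integral_add f w fw)+
    then show ?thesis
      unfolding F_def H_def K_def
      by (simp add: set_integral_add(2)[OF fw[unfolded Suc_eq_plus1[symmetric]]
            set_integrable_mult_right[OF w]] del: power_Suc)
  qed
  show ?thesis
  proof (cases "K = 0")
    case True
    \<comment> \<open>Since \<open>w\<close> is positive on \<open>A\<close>, a vanishing integral
      forces almost every point to lie outside \<open>A\<close>, so \<open>f\<close> integrates to
      \<open>0\<close> as well.\<close>
    have "AE x in M. indicator A x * w x = 0"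
      using integral_nonneg_eq_0_iff_AE[of M "\<lambda>x. indicator A x * w x"] True w w_pos
      unfolding K_def set_lebesgue_integral_def set_integrable_def
      by (auto simp: indicator_def less_imp_le)
    then have "AE x in M. indicator A x *\<^sub>R f x = 0"
      by eventually_elim (use w_pos in \<open>force simp: indicator_def\<close>)
    then have "F = 0"
      unfolding F_def set_lebesgue_integral_def by (rule integral_eq_zero_AE)
    moreover have "H \<ge> 0"
      using tangent[of 0] \<open>F = 0\<close> by simp
    ultimately show ?thesis
      using K0 unfolding F_def[symmetric] K_def[symmetric] H_def[symmetric] by simp
  next
    case False
    with K0 have K: "K > 0" by simp
    \<comment> \<open>\<open>F / K\<close> is the mean of \<open>f / w\<close> with respect to the
      weight \<open>w\<close>; among all \<open>m \<ge> 0\<close> it gives the best lower bound for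
      \<open>H\<close>, namely \<open>F ^ (n + 1) / K ^ n\<close>.\<close>
    have "(real n + 1) * (F / K) ^ n * F \<le> H + real n * (F / K) ^ (n + 1) * K"
      using F0 K0 by (intro tangent) simp
    also have "real n * (F / K) ^ (n + 1) * K = real n * (F / K) ^ n * F"
      using K by simp
    finally have "(F / K) ^ n * F \<le> H"
      by (simp add: algebra_simps)
    then have "F ^ (n + 1) \<le> K ^ n * H"
      using K by (simp add: field_simps)
    then show ?thesis
      unfolding F_def K_def H_def .
  qed
qed

text \<open>Completion keeps the measure of every set of \<open>M\<close>, so a countable cover by
  sets of finite measure still serves. For \<open>lebesgue\<close> this makes Tonelli's theorem
  available.\<close>

lemma sigma_finite_completion:
  assumes "sigma_finite_measure M"
  shows "sigma_finite_measure (completion M)"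
proof -
  from assms obtain \<A> where "countable \<A>" "\<A> \<subseteq> sets M" "\<Union>\<A> = space M"
    "\<And>A. A \<in> \<A> \<Longrightarrow> emeasure M A \<noteq> \<infinity>"
    by (meson sigma_finite_measure.sigma_finite_countable)
  then show ?thesis
    by (intro sigma_finite_measure.intro exI[of _ \<A>]) (auto simp: subset_iff)
qed

lemma sigma_finite_lebesgue: "sigma_finite_measure lebesgue"
  by (rule sigma_finite_completion[OF sigma_finite_lborel])

lemma borel_measurable_lebesgue_ident: "(\<lambda>x::real. x) \<in> borel_measurable lebesgue"
  by (simp add: measurable_completion)

text \<open>Moving the varying domain into the integrand as the condition \<open>x < t\<close> gives
  a jointly measurable function, whose partial integrals are measurable by sigma-finiteness.\<close>

lemma borel_measurable_nn_integral_greaterThan: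
  fixes h :: "real \<Rightarrow> ennreal"
  assumes [measurable]: "h \<in> borel_measurable lebesgue"
  shows "(\<lambda>x. \<integral>\<^sup>+t\<in>{x<..}. h t \<partial>lebesgue) \<in> borel_measurable lebesgue"
proof -
  interpret lebesgue: sigma_finite_measure "lebesgue :: real measure"
    by (rule sigma_finite_lebesgue)
  note borel_measurable_lebesgue_ident [measurable]
  have "(\<lambda>x. \<integral>\<^sup>+t. (if x < t then h t else 0) \<partial>lebesgue) \<in> borel_measurable lebesgue"
    by measurable
  also have "(\<lambda>x. \<integral>\<^sup>+t. (if x < t then h t else 0) \<partial>lebesgue)
      = (\<lambda>x. \<integral>\<^sup>+t\<in>{x<..}. h t \<partial>lebesgue)"
    by (intro ext nn_integral_cong) (auto simp: indicator_def)
  finally show ?thesis .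
qed

text \<open>Tonelli's theorem: both sides integrate \<open>g x * h t\<close> over the region
  \<open>x < t\<close>.\<close>

lemma nn_integral_triangle_swap:
  fixes g h :: "real \<Rightarrow> ennreal"
  assumes [measurable]: "g \<in> borel_measurable lebesgue" "h \<in> borel_measurable lebesgue"
  shows "(\<integral>\<^sup>+x. g x * (\<integral>\<^sup>+t\<in>{x<..}. h t \<partial>lebesgue) \<partial>lebesgue)
    = (\<integral>\<^sup>+t. h t * (\<integral>\<^sup>+x\<in>{..<t}. g x \<partial>lebesgue) \<partial>lebesgue)"
proof -
  interpret lebesgue: sigma_finite_measure "lebesgue :: real measure"
    by (rule sigma_finite_lebesgue)
  note borel_measurable_lebesgue_ident [measurable]
  interpret pair_sigma_finite "lebesgue :: real measure" "lebesgue :: real measure" ..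
  have "(\<integral>\<^sup>+x. g x * (\<integral>\<^sup>+t\<in>{x<..}. h t \<partial>lebesgue) \<partial>lebesgue)
      = (\<integral>\<^sup>+x. (\<integral>\<^sup>+t. (if x < t then g x * h t else 0) \<partial>lebesgue) \<partial>lebesgue)"
    by (auto simp flip: nn_integral_cmult intro!: nn_integral_cong simp: indicator_def)
  also have "\<dots> = (\<integral>\<^sup>+t. (\<integral>\<^sup>+x. (if x < t then g x * h t else 0) \<partial>lebesgue) \<partial>lebesgue)"
    by (rule Fubini') measurable
  also have "\<dots> = (\<integral>\<^sup>+t. h t * (\<integral>\<^sup>+x\<in>{..<t}. g x \<partial>lebesgue) \<partial>lebesgue)"
    by (auto simp flip: nn_integral_cmult intro!: nn_integral_cong
        simp: indicator_def mult.commute)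
  finally show ?thesis .
qed

lemma ennreal_set_integral_eq:
  fixes f :: "'a \<Rightarrow> real"
  assumes "set_integrable M A f" "\<And>x. x \<in> A \<Longrightarrow> f x \<ge> 0"
  shows "ennreal (LINT x:A|M. f x) = (\<integral>\<^sup>+x\<in>A. ennreal (f x) \<partial>M)"
proof -
  have "ennreal (LINT x:A|M. f x) = (\<integral>\<^sup>+x. ennreal (indicator A x *\<^sub>R f x) \<partial>M)"
    using assms unfolding set_lebesgue_integral_def set_integrable_def
    by (intro nn_integral_eq_integral[symmetric]) (auto simp: indicator_def)
  also have "\<dots> = (\<integral>\<^sup>+x\<in>A. ennreal (f x) \<partial>M)"
    by (intro nn_integral_cong) (auto simp: indicator_def)
  finally show ?thesis .
qed

theorem theorem2p15:
  fixes a b :: real and r s f :: "real \<Rightarrow> real" and p :: nat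
  assumes "a < b" and "p \<ge> 1"
    and "continuous_on {a<..<b} r" and "\<And>x. x \<in> {a<..<b} \<Longrightarrow> r x > 0"
    and "continuous_on {a<..<b} s" and "\<And>x. x \<in> {a<..<b} \<Longrightarrow> s x > 0"
    and "set_borel_measurable lebesgue {a<..<b} f" and "\<And>x. x \<in> {a<..<b} \<Longrightarrow> f x \<ge> 0"
    and "\<And>x. x \<in> {a<..<b} \<Longrightarrow> set_integrable lebesgue {a<..<x} r"
    and "\<And>x. x \<in> {a<..<b} \<Longrightarrow> set_integrable lebesgue {x<..<b} f"
    and "set_integrable lebesgue {a<..<b} (\<lambda>x. s x powr (- 1 / real p))"
    and "set_integrable lebesgue {a<..<b}
           (\<lambda>x. r x * (LINT t:{x<..<b}|lebesgue. f t) ^ (p + 1))"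
    and "set_integrable lebesgue {a<..<b} (\<lambda>x. s x * f x ^ (p + 1))"
  shows "ennreal (LINT x:{a<..<b}|lebesgue. r x * (LINT t:{x<..<b}|lebesgue. f t) ^ (p + 1))
    \<le> hardy_const a b r s p * ennreal (LINT x:{a<..<b}|lebesgue. s x * f x ^ (p + 1))"
proof -
  define w where "w = (\<lambda>x. s x powr (- 1 / real p))"
  define h where "h = (\<lambda>x. s x * f x ^ (p + 1))"
  define K where "K = (LINT x:{a<..<b}|lebesgue. w x)"
  define R where "R = (SUP x\<in>{a<..<b}. ennreal (LINT t:{a<..<x}|lebesgue. r t))"
  \<comment> \<open>Extending \<open>r\<close> and \<open>h\<close> by zero lets the exchange of
    integrals run over half-lines: the cut-offs at \<open>a\<close> and \<open>b\<close> are carried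
    by the functions themselves.\<close>
  define g' where "g' = (\<lambda>x. ennreal (indicator {a<..<b} x * r x))"
  define h' where "h' = (\<lambda>x. ennreal (indicator {a<..<b} x * h x))"
  note r_pos = assms(4) and s_pos = assms(6) and f_nonneg = assms(8)
  have w: "set_integrable lebesgue {a<..<b} w" and h: "set_integrable lebesgue {a<..<b} h"
    using assms unfolding w_def h_def by auto
  have h_nonneg: "h x \<ge> 0" if "x \<in> {a<..<b}" for x
    using s_pos[OF that] f_nonneg[OF that] by (simp add: h_def)
  \<comment> \<open>The exponent \<open>- 1 / p\<close> is chosen so that
    \<open>w ^ p = 1 / s\<close>, which puts \<open>h\<close> in the form required by
    \<open>Holder_power_weight\<close>.\<close>
  have h_eq: "h x = f x ^ (p + 1) / w x ^ p" if "x \<in> {a<..<b}" for x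
  proof -
    have "w x ^ p = s x powr (- 1)"
      using s_pos[OF that] assms(2) by (simp add: w_def powr_powr flip: powr_realpow)
    then show ?thesis
      using s_pos[OF that] by (simp add: h_def powr_minus divide_inverse mult.commute del: power_Suc)
  qed
  have w_pos: "w x > 0" if "x \<in> {a<..<b}" for x
    using s_pos[OF that] by (simp add: w_def)
  have K0: "K \<ge> 0"
    unfolding K_def set_lebesgue_integral_def by (simp add: w_def)

  have Holder: "(LINT t:{x<..<b}|lebesgue. f t) ^ (p + 1)
      \<le> K ^ p * (LINT t:{x<..<b}|lebesgue. h t)" if x: "x \<in> {a<..<b}" for x
  proof -
    have sub: "{x<..<b} \<subseteq> {a<..<b}" using x by auto
    have wx: "set_integrable lebesgue {x<..<b} w" and hx: "set_integrable lebesgue {x<..<b} h"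
      using w h sub by (auto intro: set_integrable_subset)
    have h_cong: "(LINT t:{x<..<b}|lebesgue. h t)
        = (LINT t:{x<..<b}|lebesgue. f t ^ (p + 1) / w t ^ p)"
      by (rule set_lebesgue_integral_cong) (simp, use sub h_eq in blast)
    have hx': "set_integrable lebesgue {x<..<b} (\<lambda>t. f t ^ (p + 1) / w t ^ p)"
      by (rule iffD1[OF set_integrable_cong hx]) (use sub h_eq in auto)
    have "(LINT t:{x<..<b}|lebesgue. f t) ^ (p + 1)
        \<le> (LINT t:{x<..<b}|lebesgue. w t) ^ p * (LINT t:{x<..<b}|lebesgue. h t)"
      unfolding h_cong
      using sub assms(10)[OF x] wx hx' f_nonneg w_pos
      by (intro Holder_power_weight) auto
    \<comment> \<open>Enlarging the weight's domain to all of \<open>(a, b)\<close> makes the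
      constant independent of \<open>x\<close>, so it can leave the outer integral.\<close>
    also have "\<dots> \<le> K ^ p * (LINT t:{x<..<b}|lebesgue. h t)"
    proof (intro mult_right_mono power_mono)
      show "(LINT t:{x<..<b}|lebesgue. w t) \<le> K"
        unfolding K_def set_lebesgue_integral_def
        using w wx sub unfolding set_integrable_def
        by (intro integral_mono) (auto simp: indicator_def w_def)
      show "0 \<le> (LINT t:{x<..<b}|lebesgue. w t)"
        unfolding set_lebesgue_integral_def by (simp add: w_def)
      show "0 \<le> (LINT t:{x<..<b}|lebesgue. h t)"
        unfolding set_lebesgue_integral_def using sub h_nonneg
        by (intro integral_nonneg_AE AE_I2) (auto simp: indicator_def)
    qed
    finally show ?thesis .
  qed

  have g'_meas [measurable]: "g' \<in> borel_measurable lebesgue"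
  proof -
    have "r \<in> borel_measurable (lebesgue_on {a<..<b})"
      by (rule continuous_imp_measurable_on_sets_lebesgue[OF assms(3)]) simp
    then show ?thesis
      unfolding g'_def by (auto simp: borel_measurable_restrict_space_iff)
  qed
  have h'_meas [measurable]: "h' \<in> borel_measurable lebesgue"
    using h unfolding h'_def set_integrable_def by auto

  \<comment> \<open>The estimate is carried out with nonnegative integrals, where the exchange needs
    only measurability and \<open>R\<close> may be \<open>\<infinity>\<close>.\<close>
  have "ennreal (LINT x:{a<..<b}|lebesgue. r x * (LINT t:{x<..<b}|lebesgue. f t) ^ (p + 1))
      = (\<integral>\<^sup>+x\<in>{a<..<b}. ennreal (r x * (LINT t:{x<..<b}|lebesgue. f t) ^ (p + 1)) \<partial>lebesgue)"
  proof (rule ennreal_set_integral_eq[OF assms(12)])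
    fix x assume x: "x \<in> {a<..<b}"
    have "0 \<le> (LINT t:{x<..<b}|lebesgue. f t)"
      unfolding set_lebesgue_integral_def using x f_nonneg
      by (intro integral_nonneg_AE) (auto simp: indicator_def)
    then show "0 \<le> r x * (LINT t:{x<..<b}|lebesgue. f t) ^ (p + 1)"
      using r_pos[OF x] by simp
  qed
  also have "\<dots> \<le> (\<integral>\<^sup>+x. ennreal (K ^ p) * (g' x * (\<integral>\<^sup>+t\<in>{x<..}. h' t \<partial>lebesgue)) \<partial>lebesgue)"
  proof (rule nn_integral_mono)
    fix x
    show "ennreal (r x * (LINT t:{x<..<b}|lebesgue. f t) ^ (p + 1)) * indicator {a<..<b} x
      \<le> ennreal (K ^ p) * (g' x * (\<integral>\<^sup>+t\<in>{x<..}. h' t \<partial>lebesgue))"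
    proof (cases "x \<in> {a<..<b}")
      case True
      have sub: "{x<..<b} \<subseteq> {a<..<b}" using True by auto
      have "ennreal (r x * (LINT t:{x<..<b}|lebesgue. f t) ^ (p + 1))
          \<le> ennreal (r x * (K ^ p * (LINT t:{x<..<b}|lebesgue. h t)))"
        using r_pos[OF True] Holder[OF True] by (intro ennreal_leI mult_left_mono) auto
      also have "\<dots> = ennreal (K ^ p) * (ennreal (r x) * ennreal (LINT t:{x<..<b}|lebesgue. h t))"
        using r_pos[OF True] K0 by (simp add: ennreal_mult' mult.left_commute)
      also have "ennreal (LINT t:{x<..<b}|lebesgue. h t) = (\<integral>\<^sup>+t\<in>{x<..<b}. ennreal (h t) \<partial>lebesgue)"
        using h sub h_nonneg by (intro ennreal_set_integral_eq) (auto intro: set_integrable_subset)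
      also have "\<dots> = (\<integral>\<^sup>+t\<in>{x<..}. h' t \<partial>lebesgue)"
        using True by (intro nn_integral_cong) (auto simp: h'_def indicator_def)
      finally show ?thesis using True by (simp add: g'_def)
    qed simp
  qed
  also have "\<dots> = ennreal (K ^ p) * (\<integral>\<^sup>+x. g' x * (\<integral>\<^sup>+t\<in>{x<..}. h' t \<partial>lebesgue) \<partial>lebesgue)"
    by (intro nn_integral_cmult borel_measurable_times_ennreal g'_meas h'_meas
        borel_measurable_nn_integral_greaterThan)
  also have "\<dots> = ennreal (K ^ p) * (\<integral>\<^sup>+t. h' t * (\<integral>\<^sup>+x\<in>{..<t}. g' x \<partial>lebesgue) \<partial>lebesgue)"
    by (simp add: nn_integral_triangle_swap)
  \<comment> \<open>For \<open>t\<close> in \<open>(a, b)\<close> the inner integral is one of the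
    terms of the supremum \<open>R\<close>; elsewhere \<open>h' t = 0\<close> and both sides vanish,
    even if \<open>R = \<infinity>\<close>.\<close>
  also have "\<dots> \<le> ennreal (K ^ p) * (\<integral>\<^sup>+t. R * h' t \<partial>lebesgue)"
  proof (intro mult_left_mono nn_integral_mono)
    fix t
    show "h' t * (\<integral>\<^sup>+x\<in>{..<t}. g' x \<partial>lebesgue) \<le> R * h' t"
    proof (cases "t \<in> {a<..<b}")
      case True
      have "(\<integral>\<^sup>+x\<in>{..<t}. g' x \<partial>lebesgue) = (\<integral>\<^sup>+x\<in>{a<..<t}. ennreal (r x) \<partial>lebesgue)"
        using True by (intro nn_integral_cong) (auto simp: g'_def indicator_def)
      also have "\<dots> = ennreal (LINT x:{a<..<t}|lebesgue. r x)"
        using True assms(9) by (intro ennreal_set_integral_eq[symmetric])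
          (auto intro: less_imp_le[OF r_pos])
      also have "\<dots> \<le> R"
        unfolding R_def using True by (rule SUP_upper)
      finally show ?thesis
        by (metis mult.commute mult_right_mono zero_le)
    qed (simp add: h'_def)
  qed simp
  also have "\<dots> = R * ennreal (K ^ p) * (\<integral>\<^sup>+t. h' t \<partial>lebesgue)"
    by (simp add: nn_integral_cmult ac_simps)
  also have "(\<integral>\<^sup>+t. h' t \<partial>lebesgue) = (\<integral>\<^sup>+t\<in>{a<..<b}. ennreal (h t) \<partial>lebesgue)"
    by (intro nn_integral_cong) (auto simp: h'_def indicator_def)
  also have "\<dots> = ennreal (LINT t:{a<..<b}|lebesgue. h t)"
    by (rule ennreal_set_integral_eq[symmetric, OF h h_nonneg])
  finally show ?thesis
    unfolding hardy_const_def R_def K_def w_def h_def .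
qed

end
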